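(* We have {\rm (i)} $\mathcal{D}_{12\mbox{-}3;0}(x)=\dfrac{1+x+x^4-x^5}{1-x^2}$; {\rm (ii)} $\mathcal{D}_{12\mbox{-}3;1}(x)=\dfrac{x^5(2+3x-4x^2-x^3+2x^4)}{(1-x^2)^2}$; {\rm (iii)} $\mathcal{D}_{12\mbox{-}3;2}(x)=\dfrac{x^7(2+2x-6x^2-x^3+6x^4+x^5-2x^6)}{(1-x^2)^3}$; {\rm (iv)} $\mathcal{D}_{12\mbox{-}3;3}(x)=\dfrac{x^7(3+5x-10x^2-9x^3+10x^4+3x^5+4x^7-5x^8-x^9+2x^{10})}{(1-x^2)^4}$; {\rm (v)} $\mathcal{D}_{12\mbox{-}3;4}(x)=\dfrac{x^9(5+5x-23x^2-7x^3+40x^4-x^5-30x^6+5x^7+5x^8-x^9+5x^{10}+x^{11}-2x^{12})}{(1-x^2)^5}$.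
   Context: A permutation $\pi$ is a Dumont permutation (of the first kind) if each even integer in $\pi$ is followed by a smaller integer, and each odd integer is either followed by a larger integer or is the last element of $\pi$. In the generalized pattern $12\mbox{-}3$, the letters corresponding to $1$ and $2$ must be adjacent in the permutation, while $3$ may occur anywhere after them. Let $\mathcal{D}_{\tau;r}(n)$ be the number of Dumont permutations of length $n$ that avoid $1\mbox{-}3\mbox{-}2$ (the classical pattern $132$) and contain $\tau$ exactly $r$ times, and $\mathcal{D}_{\tau;r}(x)=\sum_{n\geq0}\mathcal{D}_{\tau;r}(n)x^n$. *)

theory Defs
  imports
    "HOL-Combinatorics.Multiset_Permutations"
    "HOL-Computational_Algebra.Formal_Power_Series"
begin

text \<open>
  Permutations of length \<open>n\<close> are written in one-line notation, i.e. they are the members of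
  \<^term>\<open>permutations_of_set {1..n::nat}\<close>.
\<close>

definition dumont :: "nat list \<Rightarrow> bool" where
  "dumont \<pi> \<longleftrightarrow>
     (\<forall>i < length \<pi>.
        (even (\<pi> ! i) \<longrightarrow> Suc i < length \<pi> \<and> \<pi> ! Suc i < \<pi> ! i) \<and>
        (odd (\<pi> ! i) \<longrightarrow> Suc i = length \<pi> \<or> \<pi> ! i < \<pi> ! Suc i))"

text \<open>
  A generalized pattern is encoded as the word of its letters together with the set of those
  (0-based) positions whose letter is \<^emph>\<open>not\<close> separated by a dash from the next letter.
\<close>

type_synonym gpattern = "nat list \<times> nat set"

definition pattern_1_3_2 :: gpattern where
  "pattern_1_3_2 = ([1, 3, 2], {})"

definition pattern_12_3 :: gpattern where
  "pattern_12_3 = ([1, 2, 3], {0})"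

text \<open>
  An occurrence of a pattern in \<open>\<pi>\<close> is the increasing list \<open>js\<close> of the positions in \<open>\<pi>\<close> of its letters.
\<close>

definition occurrences :: "gpattern \<Rightarrow> nat list \<Rightarrow> nat list set" where
  "occurrences \<tau> \<pi> =
     {js. length js = length (fst \<tau>) \<and> sorted_wrt (<) js \<and> set js \<subseteq> {..<length \<pi>} \<and>
          (\<forall>a < length js. \<forall>b < length js.
             \<pi> ! (js ! a) < \<pi> ! (js ! b) \<longleftrightarrow> fst \<tau> ! a < fst \<tau> ! b) \<and>
          (\<forall>a \<in> snd \<tau>. js ! Suc a = Suc (js ! a))}"

definition avoids :: "nat list \<Rightarrow> gpattern \<Rightarrow> bool" where
  "avoids \<pi> \<tau> \<longleftrightarrow> occurrences \<tau> \<pi> = {}"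

definition dumont_count :: "gpattern \<Rightarrow> nat \<Rightarrow> nat \<Rightarrow> nat" where
  "dumont_count \<tau> r n =
     card {\<pi> \<in> permutations_of_set {1..n}.
             dumont \<pi> \<and> avoids \<pi> pattern_1_3_2 \<and> card (occurrences \<tau> \<pi>) = r}"

definition dumont_gf :: "gpattern \<Rightarrow> nat \<Rightarrow> rat fps" where
  "dumont_gf \<tau> r = Abs_fps (\<lambda>n. of_nat (dumont_count \<tau> r n))"

lemma avoids_1_3_2_iff:
  "avoids \<pi> pattern_1_3_2 \<longleftrightarrow>
     \<not> (\<exists>i j k. i < j \<and> j < k \<and> k < length \<pi> \<and> \<pi> ! i < \<pi> ! k \<and> \<pi> ! k < \<pi> ! j)"
proof -
  have "js \<in> occurrences pattern_1_3_2 \<pi> \<longleftrightarrow>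
      (\<exists>i j k. js = [i, j, k] \<and> i < j \<and> j < k \<and> k < length \<pi> \<and> \<pi> ! i < \<pi> ! k \<and> \<pi> ! k < \<pi> ! j)"
    for js
    unfolding occurrences_def pattern_1_3_2_def
    by (auto simp: numeral_3_eq_3 length_Suc_conv less_Suc_eq all_conj_distrib)
  then show ?thesis
    unfolding avoids_def by (metis (no_types, lifting) empty_iff equals0I)
qed

lemma card_occurrences_12_3:
  "card (occurrences pattern_12_3 \<pi>) =
     card {(i, k). Suc i < k \<and> k < length \<pi> \<and> \<pi> ! i < \<pi> ! Suc i \<and> \<pi> ! Suc i < \<pi> ! k}"
    (is "_ = card ?S")
proof -
  have "js \<in> occurrences pattern_12_3 \<pi> \<longleftrightarrow> (\<exists>i k. js = [i, Suc i, k] \<and> (i, k) \<in> ?S)" for js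
    unfolding occurrences_def pattern_12_3_def
    by (auto simp: numeral_3_eq_3 length_Suc_conv less_Suc_eq all_conj_distrib)
  then have "occurrences pattern_12_3 \<pi> = (\<lambda>(i, k). [i, Suc i, k]) ` ?S"
    by (auto simp: image_iff set_eq_iff)
  moreover have "inj_on (\<lambda>(i, k). [i, Suc i, k]) ?S"
    by (auto simp: inj_on_def)
  ultimately show ?thesis
    by (simp add: card_image)
qed

end

theory Submission
  imports Defs "HOL-Computational_Algebra.Polynomial"
begin

text \<open>
  Split a 132-avoiding permutation as \<open>L n R\<close> at its largest letter \<open>n\<close>; then every letter of \<open>L\<close>
  exceeds every letter of \<open>R\<close>. The Dumont condition forces \<open>R\<close> to be empty when \<open>n\<close> is odd and
  nonempty when \<open>n\<close> is even. The least letter of a nonempty Dumont word is odd, so when \<open>L\<close> is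
  nonempty it is an even translate of a Dumont permutation. The occurrences of 12-3 in \<open>L n R\<close> are
  those in \<open>L\<close>, those in \<open>R\<close>, and one for each ascent of \<open>L\<close>; the number of ascents of a nonempty
  Dumont word is its number of odd letters minus one, hence depends on the length only.
  Writing \<open>E\<^sub>m(q)\<close> for the distribution of 12-3 on length \<open>2m\<close>, that on length \<open>2m + 1\<close> is
  \<open>q\<^bsup>m-1\<^esup> E\<^sub>m\<close> for \<open>m \<ge> 1\<close>, and
  \<open>E\<^bsub>m+1\<^esub> = q\<^bsup>m-1\<^esup> E\<^sub>m + E\<^sub>m + \<Sum>\<^bsub>1\<le>i<m\<^esub> q\<^bsup>2i-1\<^esup> E\<^sub>i E\<^bsub>m-i\<^esub>\<close> for \<open>m \<ge> 1\<close>. Modulo \<open>q\<^sup>5\<close> and for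
  large \<open>m\<close> this is the linear recursion \<open>E\<^bsub>m+1\<^esub> = E\<^sub>m + q E\<^bsub>m-1\<^esub> + 2 q\<^sup>3 E\<^bsub>m-2\<^esub>\<close>.
\<close>

section \<open>List recursions\<close>

lemma dumont_Nil [simp]: "dumont []"
  by (simp add: dumont_def)

lemma dumont_singleton [simp]: "dumont [a] \<longleftrightarrow> odd a"
  by (auto simp: dumont_def)

lemma dumont_Cons_Cons [simp]:
  "dumont (a # b # xs) \<longleftrightarrow> (if even a then b < a else a < b) \<and> dumont (b # xs)"
  unfolding dumont_def by (auto simp: All_less_Suc2)

text \<open>On both sides the last letter of \<open>L\<close> must be odd: on the left because the
  larger letter \<open>n\<close> follows it, on the right because it ends a Dumont word.\<close>

lemma dumont_append_greater:
  assumes "\<forall>a\<in>set L. a < (n::nat)"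
  shows "dumont (L @ n # R) \<longleftrightarrow> dumont L \<and> dumont (n # R)"
  using assms by (induction L rule: induct_list012) auto

lemma dumont_Cons_greatest:
  assumes "\<forall>a\<in>set R. a < (n::nat)"
  shows "dumont (n # R) \<longleftrightarrow> (if even n then R \<noteq> [] \<and> dumont R else R = [])"
  using assms by (cases R) auto

lemma dumont_map_add_even:
  assumes "even k"
  shows "dumont (map (\<lambda>i. i + k) L) \<longleftrightarrow> dumont L"
  using assms by (induction L rule: induct_list012) auto

text \<open>An even letter is followed by a smaller one, so it cannot be least. This later fixes the
  parity of the cut between the two blocks.\<close>

lemma dumont_odd_Min:
  assumes "dumont L" "a \<in> set L" "\<forall>b\<in>set L. a \<le> b"
  shows "odd a"
proof
  assume "even a"
  obtain i where i: "i < length L" "L ! i = a"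
    using assms(2) by (auto simp: in_set_conv_nth)
  with \<open>dumont L\<close> \<open>even a\<close> have "Suc i < length L" "L ! Suc i < a"
    unfolding dumont_def by auto
  with assms(3) show False
    by (meson leD nth_mem)
qed

section \<open>Recursive form of 132-avoidance\<close>

fun avoids132 :: "nat list \<Rightarrow> bool" where
  "avoids132 [] \<longleftrightarrow> True"
| "avoids132 (x # xs) \<longleftrightarrow> sorted_wrt (\<lambda>b c. \<not> (x < c \<and> c < b)) xs \<and> avoids132 xs"

lemma avoids_1_3_2_eq_avoids132: "avoids xs pattern_1_3_2 \<longleftrightarrow> avoids132 xs"
proof (induction xs)
  case Nil
  show ?case by (simp add: avoids_1_3_2_iff)
next
  case (Cons x xs)
  let ?P = "\<lambda>\<pi> i j k. i < j \<and> j < k \<and> k < length \<pi> \<and> \<pi> ! i < \<pi> ! k \<and> \<pi> ! k < \<pi> ! (j::nat)"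
  have "(\<exists>i j k. ?P (x # xs) i j k) \<longleftrightarrow>
    (\<exists>j k. j < k \<and> k < length xs \<and> x < xs ! k \<and> xs ! k < xs ! j) \<or> (\<exists>i j k. ?P xs i j k)"
    (is "?l \<longleftrightarrow> ?r1 \<or> ?r2")
  proof
    assume ?l
    then obtain i j k where *: "?P (x # xs) i j k" by blast
    then obtain j' k' where "j = Suc j'" "k = Suc k'"
      by (metis less_nat_zero_code not0_implies_Suc)
    with * show "?r1 \<or> ?r2"
      by (cases i) (auto 0 3)
  next
    assume "?r1 \<or> ?r2"
    then show ?l
    proof
      assume ?r1
      then obtain j k where "j < k \<and> k < length xs \<and> x < xs ! k \<and> xs ! k < xs ! j" by blast
      then have "?P (x # xs) 0 (Suc j) (Suc k)" by auto
      then show ?l by blast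
    next
      assume ?r2
      then obtain i j k where "?P xs i j k" by blast
      then have "?P (x # xs) (Suc i) (Suc j) (Suc k)" by auto
      then show ?l by blast
    qed
  qed
  moreover have "sorted_wrt (\<lambda>b c. \<not> (x < c \<and> c < b)) xs \<longleftrightarrow> \<not> ?r1"
    unfolding sorted_wrt_iff_nth_less by blast
  ultimately show ?case
    using Cons.IH by (simp add: avoids_1_3_2_iff)
qed

text \<open>With \<open>n\<close> as the 3, avoidance forces \<open>R\<close> below
  \<open>L\<close>. Once this holds, no occurrence can take its 1 from \<open>L\<close> and its 2
  from \<open>R\<close>, so all lie within one block.\<close>

lemma avoids132_append_greatest:
  assumes "\<forall>a\<in>set L. a < n" "\<forall>a\<in>set R. a < n"
  shows "avoids132 (L @ n # R) \<longleftrightarrow>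
    avoids132 L \<and> avoids132 R \<and> (\<forall>a\<in>set L. \<forall>b\<in>set R. b \<le> a)"
  using assms(1)
proof (induction L)
  case Nil
  have "sorted_wrt (\<lambda>b c. \<not> (n < c \<and> c < b)) R"
    unfolding sorted_wrt_iff_nth_less using assms(2) by (metis not_less_iff_gr_or_eq nth_mem)
  then show ?case by simp
next
  case (Cons x L)
  let ?P = "\<lambda>b c. \<not> (x < c \<and> c < b)"
  have "sorted_wrt ?P (L @ n # R) \<longleftrightarrow> sorted_wrt ?P L \<and> (\<forall>c\<in>set R. c \<le> x)" (is "?l \<longleftrightarrow> ?r")
  proof
    assume ?l
    then show ?r
      using assms(2) by (auto simp: sorted_wrt_append not_less dest!: bspec)
  next
    assume r: ?r
    then have "sorted_wrt ?P R"
      unfolding sorted_wrt_iff_nth_less by (metis leD nth_mem)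
    moreover have "\<forall>b\<in>set L. b < n"
      using Cons.prems by simp
    ultimately show ?l
      using r by (fastforce simp: sorted_wrt_append)
  qed
  with Cons show ?case by auto
qed

lemma avoids132_map_add: "avoids132 (map (\<lambda>i. i + k) L) \<longleftrightarrow> avoids132 L"
  by (induction L) (auto simp: sorted_wrt_map)

section \<open>Occurrences of 12-3 and ascents\<close>

fun occ12_3 :: "nat list \<Rightarrow> nat" where
  "occ12_3 (x # y # xs) = (if x < y then length (filter (\<lambda>z. y < z) xs) else 0) + occ12_3 (y # xs)"
| "occ12_3 xs = 0"

lemma card_occurrences_eq_occ12_3: "card (occurrences pattern_12_3 xs) = occ12_3 xs"
  unfolding card_occurrences_12_3
proof (induction xs rule: occ12_3.induct)
  case (1 x y xs)
  let ?S = "\<lambda>\<pi>. {(i, k). Suc i < k \<and> k < length \<pi> \<and> \<pi> ! i < \<pi> ! Suc i \<and> \<pi> ! Suc i < \<pi> ! k}"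
  let ?K = "{k. k < length xs \<and> x < y \<and> y < xs ! k}"
  have fin: "finite (?S \<pi>)" for \<pi> :: "nat list"
    by (rule finite_subset[of _ "{..<length \<pi>} \<times> {..<length \<pi>}"]) auto
  \<comment> \<open>Pairs with \<open>i = 0\<close> use the ascent at the head; all others come from
    \<open>y # xs\<close> with both indices shifted by one.\<close>
  have "?S (x # y # xs) =
      (\<lambda>k. (0, Suc (Suc k))) ` ?K \<union> (\<lambda>(i, k). (Suc i, Suc k)) ` ?S (y # xs)" (is "?A = ?B")
  proof (intro set_eqI iffI)
    fix p assume p: "p \<in> ?A"
    obtain i k where ik: "p = (i, k)" by (cases p)
    with p have "Suc i < k" by simp
    then obtain k' where k': "k = Suc (Suc k')"
      by (metis less_nat_zero_code not0_implies_Suc Suc_less_eq)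
    show "p \<in> ?B"
    proof (cases i)
      case 0
      with p ik k' show ?thesis by auto
    next
      case (Suc i')
      with p ik k' have "(i', Suc k') \<in> ?S (y # xs)" by auto
      with ik k' Suc show ?thesis by (auto simp: image_iff)
    qed
  qed auto
  moreover have "card (?B) = card ((\<lambda>k. (0::nat, Suc (Suc k))) ` ?K)
      + card ((\<lambda>(i, k). (Suc i, Suc k)) ` ?S (y # xs))"
    by (rule card_Un_disjoint) (use fin[of "y # xs"] in auto)
  moreover have "card ((\<lambda>k. (0::nat, Suc (Suc k))) ` ?K) = card ?K"
    by (rule card_image) (auto simp: inj_on_def)
  moreover have "card ((\<lambda>(i, k). (Suc i, Suc k)) ` ?S (y # xs)) = card (?S (y # xs))"
    by (rule card_image) (auto simp: inj_on_def)
  moreover have "card ?K = (if x < y then length (filter (\<lambda>z. y < z) xs) else 0)"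
    by (auto simp: length_filter_conv_card)
  ultimately show ?case
    using 1 by simp
qed (auto simp: card_eq_0_iff)

fun ascents :: "nat list \<Rightarrow> nat" where
  "ascents (x # y # xs) = (if x < y then 1 else 0) + ascents (y # xs)"
| "ascents xs = 0"

lemma occ12_3_Cons_greatest:
  assumes "\<forall>a\<in>set R. a < n"
  shows "occ12_3 (n # R) = occ12_3 R"
  using assms by (cases R) auto

text \<open>In \<open>L @ n # R\<close> with all of \<open>L\<close> above \<open>R\<close>, the new occurrences are the ascents of \<open>L\<close>
  completed by \<open>n\<close>.\<close>

lemma occ12_3_append_greatest:
  assumes "\<forall>a\<in>set L. a < n" "\<forall>a\<in>set R. a < n" "\<forall>a\<in>set L. \<forall>b\<in>set R. b \<le> a"
  shows "occ12_3 (L @ n # R) = occ12_3 L + ascents L + occ12_3 R"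
  using assms
proof (induction L rule: induct_list012)
  case 1
  then show ?case by (simp add: occ12_3_Cons_greatest)
next
  case (2 x)
  have "filter (\<lambda>z. n < z) R = []"
    using 2 by (auto simp: filter_empty_conv)
  with 2 show ?case by (simp add: occ12_3_Cons_greatest)
next
  case (3 x y zs)
  have "filter (\<lambda>z. y < z) R = []"
    using 3 by (auto simp: filter_empty_conv)
  with 3 show ?case by simp
qed

lemma occ12_3_map_add: "occ12_3 (map (\<lambda>i. i + k) L) = occ12_3 L"
  by (induction L rule: occ12_3.induct) (auto simp: filter_map o_def)

lemma ascents_map_add: "ascents (map (\<lambda>i. i + k) L) = ascents L"
  by (induction L rule: ascents.induct) auto

text \<open>In a Dumont word an ascent starts exactly at the odd letters other than the last letter,
  which is itself odd.\<close>

lemma ascents_dumont: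
  assumes "dumont L"
  shows "ascents L = length (filter odd L) - 1"
proof -
  \<comment> \<open>The successor form keeps truncated subtraction out of the induction; for the
    empty word \<open>0 - 1 = 0\<close> gives the claim.\<close>
  have "L \<noteq> [] \<Longrightarrow> Suc (ascents L) = length (filter odd L)"
    using assms by (induction L rule: induct_list012) (auto split: if_splits)
  then show ?thesis
    by (cases "L = []") auto
qed

lemma length_filter_odd_permutation:
  assumes "L \<in> permutations_of_set {1..n}"
  shows "length (filter odd L) = Suc n div 2"
proof -
  have "card {i \<in> {1..n}. odd i} = Suc n div 2"
  proof (induction n)
    case (Suc n)
    have "{i \<in> {1..Suc n}. odd i} =
        (if odd (Suc n) then insert (Suc n) {i \<in> {1..n}. odd i} else {i \<in> {1..n}. odd i})"
      by (auto simp: le_Suc_eq)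
    with Suc show ?case by auto
  qed simp
  moreover have "length (filter odd L) = card (set (filter odd L))"
    using permutations_of_setD[OF assms] by (intro distinct_card[symmetric]) simp
  moreover have "set (filter odd L) = {i \<in> {1..n}. odd i}"
    using permutations_of_setD[OF assms] by auto
  ultimately show ?thesis by simp
qed

section \<open>Decomposition at the largest letter\<close>

definition dumont132 :: "nat \<Rightarrow> nat list set" where
  "dumont132 n = {\<pi> \<in> permutations_of_set {1..n}. dumont \<pi> \<and> avoids132 \<pi>}"

lemma finite_dumont132 [simp]: "finite (dumont132 n)"
  by (simp add: dumont132_def)

lemma dumont132_iff:
  "\<pi> \<in> dumont132 n \<longleftrightarrow> set \<pi> = {1..n} \<and> distinct \<pi> \<and> dumont \<pi> \<and> avoids132 \<pi>"
  by (auto simp: dumont132_def permutations_of_set_def)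

text \<open>The count depends on \<open>n\<close> alone, so completing the ascents contributes one
  fixed power of q per block length. Truncated subtraction gives the correct 0 at
  \<open>n = 0\<close>.\<close>

lemma ascents_dumont132:
  assumes "L \<in> dumont132 n"
  shows "ascents L = Suc n div 2 - 1"
  using assms length_filter_odd_permutation[of L n] by (simp add: dumont132_def ascents_dumont)

text \<open>A number below \<open>Max B\<close> cannot lie in \<open>A\<close>, whose elements are
  all at least \<open>Max B\<close>. So \<open>B\<close> is an initial segment and
  \<open>Max B\<close> is its size.\<close>

lemma initial_segment_of_split:
  fixes A B :: "nat set"
  assumes "A \<union> B = {1..n}" "A \<inter> B = {}" "\<forall>a\<in>A. \<forall>b\<in>B. b \<le> a"
  shows "B = {1..card B}" "A = {card B<..n}"
proof -
  have fin: "finite B"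
    using assms(1) by (metis finite_Un finite_atLeastAtMost)
  have B: "B = {1..card B}"
  proof (cases "B = {}")
    case False
    have "B = {1..Max B}"
    proof
      show "B \<subseteq> {1..Max B}"
        using fin assms(1) by auto
      show "{1..Max B} \<subseteq> B"
      proof
        fix i assume i: "i \<in> {1..Max B}"
        have M: "Max B \<in> B" using fin False by simp
        then have "Max B \<in> {1..n}" using assms(1) by blast
        then have "i \<in> A \<union> B" using assms(1) i by auto
        moreover have "i \<notin> A"
          using assms(2,3) M i by (metis IntI antisym atLeastAtMost_iff empty_iff)
        ultimately show "i \<in> B" by blast
      qed
    qed
    then show ?thesis by (metis card_atLeastAtMost diff_Suc_1)
  qed simp
  show "B = {1..card B}" by (rule B)
  have "A = {1..n} - {1..card B}"
    using assms(1,2) B by blast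
  then show "A = {card B<..n}" by auto
qed

lemma dumont132_append_greatest:
  assumes "set L \<union> set R = {1..n}" "set L \<inter> set R = {}"
  shows "L @ Suc n # R \<in> dumont132 (Suc n) \<longleftrightarrow>
    distinct L \<and> distinct R \<and> dumont L \<and> (if odd n then R \<noteq> [] \<and> dumont R else R = []) \<and>
    avoids132 L \<and> avoids132 R \<and> (\<forall>a\<in>set L. \<forall>b\<in>set R. b \<le> a)"
proof -
  have lt: "\<forall>a\<in>set L. a < Suc n" "\<forall>a\<in>set R. a < Suc n"
    using assms(1) by (auto simp: less_Suc_eq_le)
  have "set (L @ Suc n # R) = {1..Suc n}"
    using assms(1) by auto
  moreover have "Suc n \<notin> set L" "Suc n \<notin> set R"
    using lt by auto
  ultimately show ?thesis
    using assms(2) unfolding dumont132_iff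
    by (auto simp: dumont_append_greater[OF lt(1)] dumont_Cons_greatest[OF lt(2)]
      avoids132_append_greatest[OF lt])
qed

lemma dumont132_SucE:
  assumes "\<pi> \<in> dumont132 (Suc n)"
  obtains L R where "\<pi> = L @ Suc n # R" "set L \<union> set R = {1..n}" "set L \<inter> set R = {}"
proof -
  have \<pi>: "set \<pi> = {1..Suc n}" "distinct \<pi>"
    using assms by (auto simp: dumont132_iff)
  then have "Suc n \<in> set \<pi>" by simp
  then obtain L R where LR: "\<pi> = L @ Suc n # R"
    by (meson split_list)
  have "set L \<union> set R = set \<pi> - {Suc n}"
    using \<pi>(2) LR by auto
  also have "\<dots> = {1..n}"
    using \<pi>(1) by auto
  finally show thesis
    using that LR \<pi>(2) by auto
qed

lemma dumont132_odd:
  assumes "even n"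
  shows "dumont132 (Suc n) = (\<lambda>L. L @ [Suc n]) ` dumont132 n"
proof (intro set_eqI iffI)
  fix \<pi> assume \<pi>: "\<pi> \<in> dumont132 (Suc n)"
  then obtain L R where LR: "\<pi> = L @ Suc n # R" "set L \<union> set R = {1..n}" "set L \<inter> set R = {}"
    by (rule dumont132_SucE)
  from \<pi> assms have "R = []" "distinct L" "dumont L" "avoids132 L"
    unfolding LR(1) dumont132_append_greatest[OF LR(2,3)] by simp_all
  with LR(2) have "L \<in> dumont132 n"
    by (simp add: dumont132_iff)
  with LR(1) \<open>R = []\<close> show "\<pi> \<in> (\<lambda>L. L @ [Suc n]) ` dumont132 n" by simp
next
  fix \<pi> assume "\<pi> \<in> (\<lambda>L. L @ [Suc n]) ` dumont132 n"
  then obtain L where "\<pi> = L @ [Suc n]" "L \<in> dumont132 n" by blast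
  with assms show "\<pi> \<in> dumont132 (Suc n)"
    by (simp add: dumont132_append_greatest dumont132_iff[of L])
qed

definition glue :: "nat \<Rightarrow> nat \<Rightarrow> nat list \<times> nat list \<Rightarrow> nat list" where
  "glue n k = (\<lambda>(L, R). map (\<lambda>i. i + k) L @ Suc n # R)"

text \<open>The first set is the case of an empty \<open>L\<close>. Otherwise \<open>R\<close> fills
  \<open>{1..k}\<close> and the least letter of \<open>L\<close> is \<open>k + 1\<close>; it is odd,
  so \<open>k\<close> is even and lowering \<open>L\<close> by \<open>k\<close> keeps all
  parities.\<close>

lemma dumont132_even:
  assumes "odd n"
  shows "dumont132 (Suc n) = Cons (Suc n) ` dumont132 n \<union>
    (\<Union>k\<in>{k. even k \<and> 0 < k \<and> k < n}. glue n k ` (dumont132 (n - k) \<times> dumont132 k))"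
    (is "_ = ?A \<union> ?B")
proof (intro set_eqI iffI)
  fix \<pi> assume \<pi>: "\<pi> \<in> dumont132 (Suc n)"
  then obtain L R where LR: "\<pi> = L @ Suc n # R" "set L \<union> set R = {1..n}" "set L \<inter> set R = {}"
    by (rule dumont132_SucE)
  from \<pi> have *: "distinct L" "distinct R" "dumont L" "R \<noteq> []" "dumont R" "avoids132 L"
      "avoids132 R" "\<forall>a\<in>set L. \<forall>b\<in>set R. b \<le> a"
    using assms by (auto simp: LR(1) dumont132_append_greatest[OF LR(2,3)])
  define k where "k = card (set R)"
  have sets: "set R = {1..k}" "set L = {k<..n}"
    unfolding k_def using initial_segment_of_split[OF LR(2,3) *(8)] by auto
  show "\<pi> \<in> ?A \<union> ?B"
  proof (cases "L = []")
    case True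
    with LR * have "R \<in> dumont132 n" by (simp add: dumont132_iff)
    with LR True show ?thesis by simp
  next
    case False
    then have "k < n" using sets(2) by (metis greaterThanAtMost_empty leI set_empty)
    then have "odd (Suc k)"
      using dumont_odd_Min[OF *(3), of "Suc k"] sets(2) by auto
    then have "even k" by simp
    have "k > 0"
      using \<open>R \<noteq> []\<close> sets(1) by (cases k) auto
    define L' where "L' = map (\<lambda>i. i - k) L"
    have L: "L = map (\<lambda>i. i + k) L'"
      unfolding L'_def using sets(2) by (auto simp: o_def intro!: map_idI[symmetric])
    have "set L' = (\<lambda>i. i - k) ` {k<..n}"
      by (simp add: L'_def sets(2))
    also have "\<dots> = {1..n - k}"
    proof
      show "{1..n - k} \<subseteq> (\<lambda>i. i - k) ` {k<..n}"
      proof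
        fix i assume "i \<in> {1..n - k}"
        then have "i = (i + k) - k" "i + k \<in> {k<..n}" by auto
        then show "i \<in> (\<lambda>i. i - k) ` {k<..n}" by blast
      qed
    qed auto
    finally have "L' \<in> dumont132 (n - k)"
      using *(1,3,6) \<open>even k\<close> unfolding L
      by (simp add: dumont132_iff dumont_map_add_even avoids132_map_add distinct_map)
    moreover have "R \<in> dumont132 k"
      using * sets by (simp add: dumont132_iff)
    moreover have "\<pi> = glue n k (L', R)"
      by (simp add: glue_def LR(1) L)
    ultimately show ?thesis
      using \<open>even k\<close> \<open>k > 0\<close> \<open>k < n\<close> by blast
  qed
next
  fix \<pi> assume "\<pi> \<in> ?A \<union> ?B"
  then show "\<pi> \<in> dumont132 (Suc n)"
  proof
    assume "\<pi> \<in> ?A"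
    then obtain R where "\<pi> = [] @ Suc n # R" "R \<in> dumont132 n" by auto
    moreover from this have "R \<noteq> []"
      using odd_pos[OF assms] by (auto simp: dumont132_iff)
    ultimately show ?thesis
      using assms dumont132_append_greatest[of "[]" R n] by (simp add: dumont132_iff[of R])
  next
    assume "\<pi> \<in> ?B"
    then obtain k L R where k: "even k" "0 < k" "k < n" and
      LR: "L \<in> dumont132 (n - k)" "R \<in> dumont132 k" and
      \<pi>: "\<pi> = map (\<lambda>i. i + k) L @ Suc n # R"
      by (auto simp: glue_def)
    have "(\<lambda>i. i + k) ` {1..n - k} = {k<..n}"
      using k by (simp only: image_add_atLeastAtMost') auto
    then have L: "set (map (\<lambda>i. i + k) L) = {k<..n}"
      using LR(1) by (simp add: dumont132_iff)
    have R: "set R = {1..k}" "R \<noteq> []"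
      using LR(2) k by (auto simp: dumont132_iff)
    have "set (map (\<lambda>i. i + k) L) \<union> set R = {1..n}" "set (map (\<lambda>i. i + k) L) \<inter> set R = {}"
      unfolding L R using k by auto
    moreover have "\<forall>a\<in>set (map (\<lambda>i. i + k) L). \<forall>b\<in>set R. b \<le> a"
      unfolding L R by auto
    ultimately show ?thesis
      unfolding \<pi> using assms k LR R(2)
      by (simp add: dumont132_append_greatest dumont132_iff[of L] dumont132_iff[of R]
        dumont_map_add_even avoids132_map_add distinct_map)
  qed
qed

section \<open>The distribution polynomials\<close>

definition occ_poly :: "nat \<Rightarrow> rat poly" where
  "occ_poly n = (\<Sum>\<pi>\<in>dumont132 n. monom 1 (occ12_3 \<pi>))"

lemma dumont_count_eq_coeff:
  "of_nat (dumont_count pattern_12_3 r n) = coeff (occ_poly n) r"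
proof -
  have "{\<pi> \<in> permutations_of_set {1..n}. dumont \<pi> \<and> avoids \<pi> pattern_1_3_2 \<and>
      card (occurrences pattern_12_3 \<pi>) = r} = {\<pi> \<in> dumont132 n. occ12_3 \<pi> = r}"
    by (auto simp: dumont132_def avoids_1_3_2_eq_avoids132 card_occurrences_eq_occ12_3)
  then show ?thesis
    by (simp add: dumont_count_def occ_poly_def coeff_sum sum.If_cases Int_def)
qed

text \<open>A word of length \<open>2 * m\<close> has \<open>m\<close> odd letters, hence
  \<open>m - 1\<close> ascents, each completed by the final letter. At \<open>m = 0\<close>
  truncation gives the needed exponent 0.\<close>

lemma occ_poly_odd: "occ_poly (Suc (2 * m)) = monom 1 (m - 1) * occ_poly (2 * m)"
proof -
  have "occ12_3 (L @ [Suc (2 * m)]) = (m - 1) + occ12_3 L" if "L \<in> dumont132 (2 * m)" for L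
    using that ascents_dumont132[OF that]
    by (subst occ12_3_append_greatest) (auto simp: dumont132_iff less_Suc_eq_le)
  then show ?thesis
    unfolding occ_poly_def dumont132_odd[of "2 * m", simplified]
    by (simp add: sum.reindex inj_on_def sum_distrib_left mult_monom)
qed

lemma occ12_3_glue:
  assumes "k \<le> n" "L \<in> dumont132 (n - k)" "R \<in> dumont132 k"
  shows "occ12_3 (glue n k (L, R)) = (Suc (n - k) div 2 - 1) + occ12_3 L + occ12_3 R"
proof -
  have "set L = {1..n - k}" "set R = {1..k}"
    using assms(2,3) by (simp_all add: dumont132_iff)
  then have "\<forall>a\<in>set (map (\<lambda>i. i + k) L). a < Suc n" "\<forall>a\<in>set R. a < Suc n"
    "\<forall>a\<in>set (map (\<lambda>i. i + k) L). \<forall>b\<in>set R. b \<le> a"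
    using assms(1) by auto
  from occ12_3_append_greatest[OF this] show ?thesis
    using ascents_dumont132[OF assms(2)]
    by (simp add: glue_def occ12_3_map_add ascents_map_add)
qed

text \<open>The length of the left block is fixed as \<open>n - k\<close>, so the concatenation can
  be cut again uniquely.\<close>

lemma inj_on_glue: "inj_on (glue n k) (dumont132 (n - k) \<times> dumont132 k)"
proof (rule inj_onI, clarify)
  fix L R L' R'
  assume *: "L \<in> dumont132 (n - k)" "R \<in> dumont132 k" "L' \<in> dumont132 (n - k)"
    "R' \<in> dumont132 k" "glue n k (L, R) = glue n k (L', R')"
  then have "length L = length L'"
    by (metis dumont132_iff distinct_card)
  with *(5) have "map (\<lambda>i. i + k) L = map (\<lambda>i. i + k) L'" "R = R'"
    by (auto simp: glue_def)
  moreover have "inj (\<lambda>i. i + k)" by simp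
  ultimately show "L = L' \<and> R = R'"
    by (metis inj_map_eq_map)
qed

text \<open>The leading term counts the words that start with their largest letter. In summand
  \<open>i\<close> the upper block has length \<open>2 * i + 1\<close> and hence \<open>i\<close>
  ascents.\<close>

lemma occ_poly_even:
  "occ_poly (2 * Suc m) = occ_poly (Suc (2 * m)) +
     (\<Sum>i<m. monom 1 i * occ_poly (Suc (2 * i)) * occ_poly (2 * (m - i)))"
proof -
  define n where "n = Suc (2 * m)"
  define G where "G = (\<lambda>k. glue n k ` (dumont132 (n - k) \<times> dumont132 k))"
  define K where "K = {k. even k \<and> 0 < k \<and> k < n}"
  define w where "w = (\<lambda>\<pi>. monom (1::rat) (occ12_3 \<pi>))"
  have "odd n" by (simp add: n_def)
  have [simp]: "finite K" unfolding K_def by simp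
  have finG: "finite (G k)" for k by (simp add: G_def)
  \<comment> \<open>the pieces are told apart by the number of letters before the largest one\<close>
  have len: "length (takeWhile (\<lambda>i. i \<noteq> Suc n) \<pi>) = n - k" if k: "k \<in> K" and \<pi>: "\<pi> \<in> G k" for k \<pi>
  proof -
    obtain L R where LR: "L \<in> dumont132 (n - k)" "R \<in> dumont132 k" "\<pi> = glue n k (L, R)"
      using \<pi> by (auto simp: G_def)
    have "\<forall>a\<in>set (map (\<lambda>i. i + k) L). a \<noteq> Suc n"
      using LR(1) k by (auto simp: dumont132_iff K_def)
    then have "takeWhile (\<lambda>i. i \<noteq> Suc n) \<pi> = map (\<lambda>i. i + k) L"
      by (simp add: LR(3) glue_def takeWhile_append)
    then show ?thesis
      using LR(1) distinct_card[of L] by (simp add: dumont132_iff)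
  qed
  have disj: "G k \<inter> G k' = {}" if "k \<in> K" "k' \<in> K" "k \<noteq> k'" for k k'
  proof -
    have "n - k \<noteq> n - k'" using that by (auto simp: K_def)
    then show ?thesis using len that(1,2) by (metis disjoint_iff)
  qed
  \<comment> \<open>Nothing precedes the largest letter in words of the first kind, whereas
    \<open>n - k > 0\<close> letters precede it in \<open>G k\<close>.\<close>
  have disj0: "Cons (Suc n) ` dumont132 n \<inter> (\<Union>k\<in>K. G k) = {}"
  proof -
    have False if "R \<in> dumont132 n" "k \<in> K" "Suc n # R \<in> G k" for R k
      using len[OF that(2,3)] that(2) by (simp add: K_def)
    then show ?thesis by blast
  qed
  have piece: "sum w (G k) = monom 1 (Suc (n - k) div 2 - 1) * occ_poly (n - k) * occ_poly k"
    if "k \<in> K" for k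
  proof -
    have "k \<le> n" using that by (simp add: K_def)
    have "sum w (G k) = (\<Sum>p\<in>dumont132 (n - k) \<times> dumont132 k. w (glue n k p))"
      unfolding G_def by (simp add: sum.reindex[OF inj_on_glue])
    also have "\<dots> = (\<Sum>(L, R)\<in>dumont132 (n - k) \<times> dumont132 k.
        monom 1 (Suc (n - k) div 2 - 1) * (w L * w R))"
      by (rule sum.cong) (auto simp: w_def occ12_3_glue[OF \<open>k \<le> n\<close>] mult_monom add.assoc)
    also have "\<dots> = monom 1 (Suc (n - k) div 2 - 1) * (occ_poly (n - k) * occ_poly k)"
      unfolding occ_poly_def w_def[symmetric] sum_product
      by (simp add: sum.cartesian_product sum_distrib_left case_prod_unfold)
    finally show ?thesis by (simp add: mult.assoc)
  qed
  have "occ_poly (Suc n) = sum w (Cons (Suc n) ` dumont132 n \<union> (\<Union>k\<in>K. G k))"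
    unfolding occ_poly_def w_def[symmetric] K_def G_def dumont132_even[OF \<open>odd n\<close>] ..
  also have "\<dots> = sum w (Cons (Suc n) ` dumont132 n) + sum w (\<Union>k\<in>K. G k)"
    by (rule sum.union_disjoint) (auto simp: finG disj0)
  also have "sum w (Cons (Suc n) ` dumont132 n) = (\<Sum>R\<in>dumont132 n. w (Suc n # R))"
    by (simp add: sum.reindex)
  also have "\<dots> = occ_poly n"
    unfolding occ_poly_def w_def
    by (intro sum.cong refl arg_cong[where f = "monom 1"] occ12_3_Cons_greatest)
      (auto simp: dumont132_iff)
  also have "sum w (\<Union>k\<in>K. G k) = (\<Sum>k\<in>K. sum w (G k))"
    by (rule sum.UNION_disjoint) (auto simp: finG disj)
  also have "\<dots> = (\<Sum>k\<in>K. monom 1 (Suc (n - k) div 2 - 1) * occ_poly (n - k) * occ_poly k)"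
    by (rule sum.cong) (auto simp: piece)
  \<comment> \<open>Put \<open>k = 2 * (m - i)\<close>; then \<open>n - k = 2 * i + 1\<close>, and
    \<open>0 < k\<close> becomes \<open>i < m\<close>.\<close>
  also have "\<dots> = (\<Sum>i<m. monom 1 i * occ_poly (Suc (2 * i)) * occ_poly (2 * (m - i)))"
  proof (rule sum.reindex_bij_witness[of _ "\<lambda>i. 2 * (m - i)" "\<lambda>k. m - k div 2"])
    fix k assume k: "k \<in> K"
    then obtain j where j: "k = 2 * j" by (auto simp: K_def)
    with k have "0 < j" "j \<le> m" by (auto simp: K_def n_def)
    then have "n - k = Suc (2 * (m - j))"
      by (auto simp: j n_def)
    with \<open>0 < j\<close> \<open>j \<le> m\<close> show "2 * (m - (m - k div 2)) = k" "m - k div 2 \<in> {..<m}"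
      "monom 1 (m - k div 2) * occ_poly (Suc (2 * (m - k div 2))) *
         occ_poly (2 * (m - (m - k div 2))) =
       monom 1 (Suc (n - k) div 2 - 1) * occ_poly (n - k) * occ_poly k"
      by (auto simp: j)
  qed (auto simp: K_def n_def)
  finally show ?thesis by (simp add: n_def)
qed

section \<open>Even lengths: recursion, initial values, truncation\<close>

definition even_occ_poly :: "nat \<Rightarrow> rat poly" where
  "even_occ_poly m = occ_poly (2 * m)"

lemma even_occ_poly_0: "even_occ_poly 0 = 1"
proof -
  have "dumont132 0 = {[]}"
    by (auto simp: dumont132_iff)
  then show ?thesis
    by (simp add: even_occ_poly_def occ_poly_def)
qed

text \<open>The exponent adds the \<open>i\<close> ascents of the upper block to the
  \<open>i - 1\<close> from \<open>occ_poly_odd\<close>. At \<open>i = 0\<close> truncation makes it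
  0, so that summand is \<open>even_occ_poly m\<close>.\<close>

lemma even_occ_poly_Suc:
  "even_occ_poly (Suc m) = monom 1 (m - 1) * even_occ_poly m +
     (\<Sum>i<m. monom 1 (i + (i - 1)) * (even_occ_poly i * even_occ_poly (m - i)))"
  unfolding even_occ_poly_def occ_poly_even occ_poly_odd
  by (simp only: mult.assoc[symmetric] mult_monom mult_1_left)

text \<open>Initial data: the linear recursion modulo q^5 is used from index 7 on, and the first two
  values supply its coefficients 1 and 2.\<close>

lemma even_occ_poly_values:
  "even_occ_poly 1 = [:1:]"
  "even_occ_poly 2 = [:2:]"
  "even_occ_poly 3 = [:2, 3:]"
  "even_occ_poly 4 = [:2, 5, 2, 5:]"
  "even_occ_poly 5 = [:2, 7, 5, 11, 5, 4, 8:]"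
  "even_occ_poly 6 = [:2, 9, 10, 17, 18, 15, 19, 13, 10, 6, 13:]"
proof -
  note rec = even_occ_poly_Suc[of 0] even_occ_poly_Suc[of 1] even_occ_poly_Suc[of 2]
    even_occ_poly_Suc[of 3] even_occ_poly_Suc[of 4] even_occ_poly_Suc[of 5]
  note ev = even_occ_poly_0 lessThan_Suc eval_nat_numeral monom_Suc monom_0 one_pCons numeral_poly
  show 1: "even_occ_poly 1 = [:1:]"
    using rec(1) by (simp add: ev)
  show 2: "even_occ_poly 2 = [:2:]"
    using rec(2) 1 by (simp add: ev)
  show 3: "even_occ_poly 3 = [:2, 3:]"
    using rec(3) 1 2 by (simp add: ev)
  show 4: "even_occ_poly 4 = [:2, 5, 2, 5:]"
    using rec(4) 1 2 3 by (simp add: ev)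
  show 5: "even_occ_poly 5 = [:2, 7, 5, 11, 5, 4, 8:]"
    using rec(5) 1 2 3 4 by (simp add: ev)
  show "even_occ_poly 6 = [:2, 9, 10, 17, 18, 15, 19, 13, 10, 6, 13:]"
    using rec(6) 1 2 3 4 5 by (simp add: ev)
qed

text \<open>Up to \<open>q\<^sup>4\<close>, only the summands \<open>i = 0, 1, 2\<close> of the recursion survive.\<close>

lemma coeff_even_occ_poly_Suc:
  assumes "6 \<le> m" "r \<le> 4"
  shows "coeff (even_occ_poly (Suc m)) r = coeff (even_occ_poly m) r +
    (if r < 1 then 0 else coeff (even_occ_poly (m - 1)) (r - 1)) +
    2 * (if r < 3 then 0 else coeff (even_occ_poly (m - 2)) (r - 3))"
proof -
  define f where "f i = monom 1 (i + (i - 1)) * (even_occ_poly i * even_occ_poly (m - i))" for i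
  \<comment> \<open>The exponent \<open>i + (i - 1)\<close> is at least 5 here.\<close>
  have "coeff (f i) r = 0" if "i \<ge> 3" for i
    using that assms(2) by (simp add: f_def coeff_monom_mult)
  then have "(\<Sum>i<m. coeff (f i) r) = (\<Sum>i<3. coeff (f i) r)"
    using assms(1) by (intro sum.mono_neutral_right) auto
  also have "\<dots> = coeff (f 0) r + coeff (f 1) r + coeff (f 2) r"
    by (simp add: eval_nat_numeral)
  also have "coeff (f 0) r = coeff (even_occ_poly m) r"
    by (simp add: f_def even_occ_poly_0)
  also have "coeff (f 1) r = (if r < 1 then 0 else coeff (even_occ_poly (m - 1)) (r - 1))"
    unfolding f_def even_occ_poly_values by (simp add: coeff_monom_mult)
  also have "coeff (f 2) r = 2 * (if r < 3 then 0 else coeff (even_occ_poly (m - 2)) (r - 3))"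
    unfolding f_def even_occ_poly_values by (simp add: coeff_monom_mult)
  \<comment> \<open>As \<open>6 \<le> m\<close>, the factor \<open>monom 1 (m - 1)\<close> makes the
    leading term of the recursion vanish too.\<close>
  finally show ?thesis
    using assms unfolding even_occ_poly_Suc f_def[symmetric]
    by (simp add: coeff_sum coeff_monom_mult)
qed

section \<open>The generating functions\<close>

unbundle fps_syntax

definition even_gf :: "nat \<Rightarrow> rat fps" where
  "even_gf r = Abs_fps (\<lambda>n. if even n then coeff (even_occ_poly (n div 2)) r else 0)"

definition odd_gf :: "nat \<Rightarrow> rat fps" where
  "odd_gf r = Abs_fps (\<lambda>n. if odd n then coeff (occ_poly n) r else 0)"

lemma dumont_gf_eq: "dumont_gf pattern_12_3 r = even_gf r + odd_gf r"
  by (rule fps_ext)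
    (auto simp: dumont_gf_def even_gf_def odd_gf_def even_occ_poly_def dumont_count_eq_coeff)

lemma even_gf_nth: "even_gf r $ (2 * m) = coeff (even_occ_poly m) r"
  by (simp add: even_gf_def)

text \<open>Shifting \<open>m\<close> by one is multiplication by x^2. \<open>C\<close> corrects the
  recursion below \<open>m = 7\<close>, so only seven coefficients need checking. \<open>D\<close>
  is separate so that the conditionals can be resolved for numeral \<open>r\<close>.\<close>

lemma even_gf_eqI:
  assumes "r \<le> 4"
  assumes "\<And>m. C $ Suc (2 * m) = 0" "\<And>m. m \<ge> 7 \<Longrightarrow> C $ (2 * m) = 0"
  assumes "\<And>m. m < 7 \<Longrightarrow> coeff (even_occ_poly m) r =
    (if m < 1 then 0 else coeff (even_occ_poly (m - 1)) r) +
    (if m < 2 \<or> r < 1 then 0 else coeff (even_occ_poly (m - 2)) (r - 1)) +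
    2 * (if m < 3 \<or> r < 3 then 0 else coeff (even_occ_poly (m - 3)) (r - 3)) + C $ (2 * m)"
  assumes "D = fps_X ^ 2 * even_gf r +
    (if r < 1 then 0 else fps_X ^ 4 * even_gf (r - 1)) +
    2 * (if r < 3 then 0 else fps_X ^ 6 * even_gf (r - 3)) + C"
  shows "even_gf r = D"
  unfolding assms(5)
proof (rule fps_ext)
  fix n
  let ?R = "fps_X ^ 2 * even_gf r +
    (if r < 1 then 0 else fps_X ^ 4 * even_gf (r - 1)) +
    2 * (if r < 3 then 0 else fps_X ^ 6 * even_gf (r - 3)) + C"
  show "even_gf r $ n = ?R $ n"
  proof (cases "even n")
    case False
    then obtain m where "n = Suc (2 * m)" by (metis oddE Suc_eq_plus1)
    with assms(2) show ?thesis
      by (simp add: numeral_fps_const even_gf_def fps_X_power_mult_nth)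
  next
    case True
    then obtain m where n: "n = 2 * m" by blast
    have "(2 * m - 2) div 2 = m - 1" "(2 * m - 4) div 2 = m - 2" "(2 * m - 6) div 2 = m - 3"
      by simp_all
    then have "?R $ n = (if m < 1 then 0 else coeff (even_occ_poly (m - 1)) r) +
      (if m < 2 \<or> r < 1 then 0 else coeff (even_occ_poly (m - 2)) (r - 1)) +
      2 * (if m < 3 \<or> r < 3 then 0 else coeff (even_occ_poly (m - 3)) (r - 3)) + C $ (2 * m)"
      by (auto simp: n numeral_fps_const fps_X_power_mult_nth even_gf_def)
    also have "\<dots> = coeff (even_occ_poly m) r"
    proof (cases "m < 7")
      case False
      then obtain m' where "m = Suc m'" "m' \<ge> 6" by (cases m) auto
      moreover have "C $ (2 * m) = 0"
        using assms(3) False by simp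
      ultimately show ?thesis
        using assms(1) coeff_even_occ_poly_Suc[of m' r]
        by (auto simp: numeral_3_eq_3 numeral_2_eq_2)
    qed (use assms(4) in simp)
    finally show ?thesis by (simp add: n even_gf_nth)
  qed
qed

lemmas coeff_eval = even_occ_poly_0 even_occ_poly_values even_occ_poly_values(1)[unfolded One_nat_def]
  coeff_pCons' coeff_1 numeral_fps_const fps_X_power_mult_nth

lemma less_7_cases:
  assumes "m < (7::nat)"
  shows "m = 0 \<or> m = 1 \<or> m = 2 \<or> m = 3 \<or> m = 4 \<or> m = 5 \<or> m = 6"
  using assms by auto

text \<open>The trailing polynomials are the defects of the linear recursion at
  \<open>m < 7\<close>, read off from the initial values.\<close>

lemma even_gf_eqs:
  fixes x :: "rat fps"
  defines "x \<equiv> fps_X"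
  shows "even_gf 0 = x^2 * even_gf 0 + (1 + x^4)"
    and "even_gf 1 = x^2 * even_gf 1 + x^4 * even_gf 0 + (2 * x^6 - x^4)"
    and "even_gf 2 = x^2 * even_gf 2 + x^4 * even_gf 1 + 2 * x^8"
    and "even_gf 3 = x^2 * even_gf 3 + x^4 * even_gf 2 + 2 * (x^6 * even_gf 0) +
      (3 * x^8 + 2 * x^10 - 2 * x^6)"
    and "even_gf 4 = x^2 * even_gf 4 + x^4 * even_gf 3 + 2 * (x^6 * even_gf 1) +
      (5 * x^10 + 2 * x^12)"
proof -
  show "even_gf 0 = x^2 * even_gf 0 + (1 + x^4)"
    unfolding x_def
    by (rule even_gf_eqI[where C = "1 + x^4", unfolded x_def];
        auto dest!: less_7_cases simp: coeff_eval; presburger)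
  show "even_gf 1 = x^2 * even_gf 1 + x^4 * even_gf 0 + (2 * x^6 - x^4)"
    unfolding x_def
    by (rule even_gf_eqI[where C = "2 * x^6 - x^4", unfolded x_def];
        auto dest!: less_7_cases simp: coeff_eval; presburger)
  show "even_gf 2 = x^2 * even_gf 2 + x^4 * even_gf 1 + 2 * x^8"
    unfolding x_def
    by (rule even_gf_eqI[where C = "2 * x^8", unfolded x_def];
        auto dest!: less_7_cases simp: coeff_eval; presburger)
  show "even_gf 3 = x^2 * even_gf 3 + x^4 * even_gf 2 + 2 * (x^6 * even_gf 0) +
      (3 * x^8 + 2 * x^10 - 2 * x^6)"
    unfolding x_def
    by (rule even_gf_eqI[where C = "3 * x^8 + 2 * x^10 - 2 * x^6", unfolded x_def];
        auto dest!: less_7_cases simp: coeff_eval; presburger)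
  show "even_gf 4 = x^2 * even_gf 4 + x^4 * even_gf 3 + 2 * (x^6 * even_gf 1) +
      (5 * x^10 + 2 * x^12)"
    unfolding x_def
    by (rule even_gf_eqI[where C = "5 * x^10 + 2 * x^12", unfolded x_def];
        auto dest!: less_7_cases simp: coeff_eval; presburger)
qed

text \<open>The factor q^(m-1) leaves nothing at q^r once \<open>m > r + 1\<close>, so each odd half
  is a polynomial.\<close>

lemma odd_gf_eqI:
  assumes "r \<le> 4" "\<And>m. C $ (2 * m) = 0" "\<And>m. m \<ge> 7 \<Longrightarrow> C $ Suc (2 * m) = 0"
  assumes "\<And>m. m < 7 \<Longrightarrow>
    C $ Suc (2 * m) = (if r < m - 1 then 0 else coeff (even_occ_poly m) (r - (m - 1)))"
  shows "odd_gf r = C"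
proof (rule fps_ext)
  fix n
  show "odd_gf r $ n = C $ n"
  proof (cases "even n")
    case True
    with assms(2) show ?thesis by (auto simp: odd_gf_def)
  next
    case False
    then obtain m where n: "n = Suc (2 * m)" by (metis oddE Suc_eq_plus1)
    have "odd_gf r $ n = (if r < m - 1 then 0 else coeff (even_occ_poly m) (r - (m - 1)))"
      by (simp add: n odd_gf_def occ_poly_odd coeff_monom_mult even_occ_poly_def)
    with assms show ?thesis
      by (cases "m < 7") (auto simp: n)
  qed
qed

lemma odd_gf_eqs:
  fixes x :: "rat fps"
  defines "x \<equiv> fps_X"
  shows "odd_gf 0 = x + x^3"
    and "odd_gf 1 = 2 * x^5"
    and "odd_gf 2 = 2 * x^7"
    and "odd_gf 3 = 3 * x^7 + 2 * x^9"
    and "odd_gf 4 = 5 * x^9 + 2 * x^11"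
proof -
  show "odd_gf 0 = x + x^3"
    unfolding x_def by (rule odd_gf_eqI; auto dest!: less_7_cases simp: coeff_eval; presburger)
  show "odd_gf 1 = 2 * x^5"
    unfolding x_def by (rule odd_gf_eqI; auto dest!: less_7_cases simp: coeff_eval; presburger)
  show "odd_gf 2 = 2 * x^7"
    unfolding x_def by (rule odd_gf_eqI; auto dest!: less_7_cases simp: coeff_eval; presburger)
  show "odd_gf 3 = 3 * x^7 + 2 * x^9"
    unfolding x_def by (rule odd_gf_eqI; auto dest!: less_7_cases simp: coeff_eval; presburger)
  show "odd_gf 4 = 5 * x^9 + 2 * x^11"
    unfolding x_def by (rule odd_gf_eqI; auto dest!: less_7_cases simp: coeff_eval; presburger)
qed

section \<open>Closed forms for \<open>r \<le> 4\<close>\<close>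

theorem theorem3p6:
  "let x = (fps_X :: rat fps) in
     dumont_gf pattern_12_3 0 = (1 + x + x^4 - x^5) / (1 - x^2) \<and>
     dumont_gf pattern_12_3 1 =
       x^5 * (2 + 3*x - 4*x^2 - x^3 + 2*x^4) / (1 - x^2)^2 \<and>
     dumont_gf pattern_12_3 2 =
       x^7 * (2 + 2*x - 6*x^2 - x^3 + 6*x^4 + x^5 - 2*x^6) / (1 - x^2)^3 \<and>
     dumont_gf pattern_12_3 3 =
       x^7 * (3 + 5*x - 10*x^2 - 9*x^3 + 10*x^4 + 3*x^5 + 4*x^7 - 5*x^8 - x^9 + 2*x^10)
         / (1 - x^2)^4 \<and>
     dumont_gf pattern_12_3 4 =
       x^9 * (5 + 5*x - 23*x^2 - 7*x^3 + 40*x^4 - x^5 - 30*x^6 + 5*x^7 + 5*x^8 - x^9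
              + 5*x^10 + x^11 - 2*x^12) / (1 - x^2)^5"
proof -
  define x where "x = (fps_X :: rat fps)"
  define u where "u = 1 - x^2"
  note A = even_gf_eqs[folded x_def] and B = odd_gf_eqs[folded x_def]
  have "u $ 0 = 1" by (simp add: u_def x_def)
  then have u: "u \<noteq> 0" by auto
  have div: "f = N / u ^ k" if "f * u ^ k = N" for f N k
    using that u by (metis nonzero_mult_div_cancel_right power_not_zero)
  \<comment> \<open>Successively, \<open>even_gf r * u^(r+1)\<close> becomes a polynomial in
    \<open>x\<close>: the equation expresses \<open>even_gf r * u\<close> by earlier series, and a
    further factor \<open>u^r\<close> clears their denominators.\<close>
  have 0: "even_gf 0 * u = 1 + x^4"
    using A(1) unfolding u_def by algebra
  have "even_gf 1 * u = x^4 * even_gf 0 + (2 * x^6 - x^4)"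
    using A(2) unfolding u_def by algebra
  then have 1: "even_gf 1 * u^2 = x^4 * (1 + x^4) + (2 * x^6 - x^4) * u"
    using 0 by algebra
  have "even_gf 2 * u = x^4 * even_gf 1 + 2 * x^8"
    using A(3) unfolding u_def by algebra
  then have 2: "even_gf 2 * u^3 = x^4 * (even_gf 1 * u^2) + 2 * x^8 * u^2"
    by algebra
  have "even_gf 3 * u = x^4 * even_gf 2 + 2 * (x^6 * even_gf 0) + (3 * x^8 + 2 * x^10 - 2 * x^6)"
    using A(4) unfolding u_def by algebra
  then have 3: "even_gf 3 * u^4 = x^4 * (even_gf 2 * u^3) + 2 * x^6 * (even_gf 0 * u) * u^2 +
      (3 * x^8 + 2 * x^10 - 2 * x^6) * u^3"
    by algebra
  have "even_gf 4 * u = x^4 * even_gf 3 + 2 * (x^6 * even_gf 1) + (5 * x^10 + 2 * x^12)"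
    using A(5) unfolding u_def by algebra
  then have 4: "even_gf 4 * u^5 = x^4 * (even_gf 3 * u^4) + 2 * x^6 * (even_gf 1 * u^2) * u^2 +
      (5 * x^10 + 2 * x^12) * u^4"
    by algebra
  \<comment> \<open>The odd halves are polynomials already, so after expanding \<open>u\<close> only
    polynomial identities in \<open>x\<close> remain.\<close>
  have "dumont_gf pattern_12_3 0 * u = 1 + x + x^4 - x^5"
    unfolding dumont_gf_eq distrib_right B 0 unfolding u_def by algebra
  moreover have "dumont_gf pattern_12_3 1 * u^2 = x^5 * (2 + 3*x - 4*x^2 - x^3 + 2*x^4)"
    unfolding dumont_gf_eq distrib_right B 1 unfolding u_def by algebra
  moreover have "dumont_gf pattern_12_3 2 * u^3 =
      x^7 * (2 + 2*x - 6*x^2 - x^3 + 6*x^4 + x^5 - 2*x^6)"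
    unfolding dumont_gf_eq distrib_right B 2 1 unfolding u_def by algebra
  moreover have "dumont_gf pattern_12_3 3 * u^4 =
      x^7 * (3 + 5*x - 10*x^2 - 9*x^3 + 10*x^4 + 3*x^5 + 4*x^7 - 5*x^8 - x^9 + 2*x^10)"
    unfolding dumont_gf_eq distrib_right B 3 2 1 0 unfolding u_def by algebra
  moreover have "dumont_gf pattern_12_3 4 * u^5 =
      x^9 * (5 + 5*x - 23*x^2 - 7*x^3 + 40*x^4 - x^5 - 30*x^6 + 5*x^7 + 5*x^8 - x^9
              + 5*x^10 + x^11 - 2*x^12)"
    unfolding dumont_gf_eq distrib_right B 4 3 2 1 0 unfolding u_def by algebra
  ultimately show ?thesis
    unfolding Let_def x_def[symmetric] u_def[symmetric]
    by (intro conjI div[where k = 1, unfolded power_one_right] div)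
qed

end
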